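(* Let $A$ be an ordinary formula such that $\vdash_c A$. Then $A$ has a minimal label.
   Context: Ordinary formulas. Let $\mathcal V=\{X,Y,Z,\dots\}$ be a countable set of propositional variables and $\perp$ a constant. Ordinary formulas are built from $\mathcal V\cup\{\perp\}$ using $\wedge,\vee,\to$; $\neg A$ abbreviates $A\to\perp$. $\vdash_c A$ means that $A$ is derivable in ordinary propositional classical logic PLC. Mixed formulas. Let $\mathcal V_m=\{X_m:X\in\mathcal V\}$, $\mathcal V_i=\{X_i:X\in\mathcal V\}$, $\mathcal V_c=\{X_c:X\in\mathcal V\}$ be three disjoint indexed copies of $\mathcal V$ (minimal, intuitionistic and classical variables). Mixed formulas are built from $\mathcal V_m\cup\mathcal V_i\cup\mathcal V_c\cup\{\perp\}$ using $\wedge,\vee,\to$, with $\neg A=A\to\perp$. A mixed formula is classical if all its variables are in $\mathcal V_c$, and intuitionistic if all its variables are in $\mathcal V_i\cup\mathcal V_c$. The system PML (on mixed formulas). Sequents are $\Gamma\vdash A$ with $\Gamma\cup\{A\}$ a finite set of mixed formulas; commas denote union. Rules ($j\in\{1,2\}$): (Ax) $A\vdash A$; (W) from $\Gamma\vdash A$ infer $\Gamma,B\vdash A$; ($\wedge_I$) from $\Gamma_1\vdash A_1$ and $\Gamma_2\vdash A_2$ infer $\Gamma_1,\Gamma_2\vdash A_1\wedge A_2$; ($\wedge_E$) from $\Gamma\vdash A_1\wedge A_2$ infer $\Gamma\vdash A_j$; ($\vee_I$) from $\Gamma\vdash A_j$ infer $\Gamma\vdash A_1\vee A_2$; ($\vee_E$)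 from $\Gamma_1\vdash A_1\vee A_2$, $\Gamma_2,A_1\vdash B$ and $\Gamma_3,A_2\vdash B$ infer $\Gamma_1,\Gamma_2,\Gamma_3\vdash B$; ($\to_I$) from $\Gamma,A_1\vdash A_2$ infer $\Gamma\vdash A_1\to A_2$; ($\to_E$) from $\Gamma_1\vdash A_1\to A_2$ and $\Gamma_2\vdash A_1$ infer $\Gamma_1,\Gamma_2\vdash A_2$; ($\perp_i$) from $\Gamma\vdash\perp$ infer $\Gamma\vdash A$, provided $A$ is an intuitionistic mixed formula; ($\perp_c$) from $\Gamma\vdash\neg\neg A$ infer $\Gamma\vdash A$, provided $A$ is a classical mixed formula. $\vdash_{pml}$ denotes derivability with these rules. Labels. A label is a function $l$ on $\mathcal V$ with $l(X)\in\{X_m,X_i,X_c\}$ for every $X\in\mathcal V$; it is extended to ordinary formulas by $l(\perp)=\perp$ and $l(A\diamond B)=l(A)\diamond l(B)$ for $\diamond\in\{\wedge,\vee,\to\}$. With $X_m<X_i<X_c$ for each $X$, put $l<l'$ iff $l(X)\le l'(X)$ for all $X\in\mathcal V$ and $l(X)<l'(X)$ for some $X\in\mathcal V$; $l\le l'$ means $l<l'$ or $l=l'$. For an ordinary formula $A$ with $\vdash_c A$, a label for $A$ is a label $l$ such that $\vdash_{pml}l(A)$ and $l(X)=X_m$ for every variable $X$ not appearing in $A$. A minimal label for $A$ is a label $l$ for $A$ such that every label $l'$ for $A$ with $l'\le l$ satisfies $l'=l$. *)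

theory Defs
  imports Main "HOL-Library.FSet" "HOL-Library.Countable"
begin

datatype (vars: 'a) form =
    Var 'a
  | Bot
  | And "'a form" "'a form"
  | Or "'a form" "'a form"
  | Imp "'a form" "'a form"

abbreviation Neg :: "'a form \<Rightarrow> 'a form" where
  "Neg A \<equiv> Imp A Bot"

text \<open>Ordinary formulas over a type \<open>'v\<close> of variables are of type \<open>'v form\<close>; mixed
  formulas are formulas over three disjoint copies of \<open>'v\<close>.\<close>

datatype 'v mvar =
    VarM 'v
  | VarI 'v
  | VarC 'v

type_synonym 'v mixed = "'v mvar form"

definition classical :: "'v mixed \<Rightarrow> bool" where
  "classical A \<longleftrightarrow> vars A \<subseteq> range VarC"

definition intuitionistic :: "'v mixed \<Rightarrow> bool" where
  "intuitionistic A \<longleftrightarrow> vars A \<subseteq> range VarI \<union> range VarC"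

text \<open>Classical propositional logic is natural deduction with double negation elimination
  for all formulas, which subsumes ex falso quodlibet.\<close>

inductive plc :: "'v form fset \<Rightarrow> 'v form \<Rightarrow> bool"  (infix "\<turnstile>\<^sub>c" 50) where
  Ax: "{|A|} \<turnstile>\<^sub>c A"
| W: "\<Gamma> \<turnstile>\<^sub>c A \<Longrightarrow> finsert B \<Gamma> \<turnstile>\<^sub>c A"
| AndI: "\<Gamma>\<^sub>1 \<turnstile>\<^sub>c A\<^sub>1 \<Longrightarrow> \<Gamma>\<^sub>2 \<turnstile>\<^sub>c A\<^sub>2 \<Longrightarrow> \<Gamma>\<^sub>1 |\<union>| \<Gamma>\<^sub>2 \<turnstile>\<^sub>c And A\<^sub>1 A\<^sub>2"
| AndE1: "\<Gamma> \<turnstile>\<^sub>c And A\<^sub>1 A\<^sub>2 \<Longrightarrow> \<Gamma> \<turnstile>\<^sub>c A\<^sub>1"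
| AndE2: "\<Gamma> \<turnstile>\<^sub>c And A\<^sub>1 A\<^sub>2 \<Longrightarrow> \<Gamma> \<turnstile>\<^sub>c A\<^sub>2"
| OrI1: "\<Gamma> \<turnstile>\<^sub>c A\<^sub>1 \<Longrightarrow> \<Gamma> \<turnstile>\<^sub>c Or A\<^sub>1 A\<^sub>2"
| OrI2: "\<Gamma> \<turnstile>\<^sub>c A\<^sub>2 \<Longrightarrow> \<Gamma> \<turnstile>\<^sub>c Or A\<^sub>1 A\<^sub>2"
| OrE: "\<Gamma>\<^sub>1 \<turnstile>\<^sub>c Or A\<^sub>1 A\<^sub>2 \<Longrightarrow> finsert A\<^sub>1 \<Gamma>\<^sub>2 \<turnstile>\<^sub>c B \<Longrightarrow> finsert A\<^sub>2 \<Gamma>\<^sub>3 \<turnstile>\<^sub>c B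
    \<Longrightarrow> \<Gamma>\<^sub>1 |\<union>| \<Gamma>\<^sub>2 |\<union>| \<Gamma>\<^sub>3 \<turnstile>\<^sub>c B"
| ImpI: "finsert A\<^sub>1 \<Gamma> \<turnstile>\<^sub>c A\<^sub>2 \<Longrightarrow> \<Gamma> \<turnstile>\<^sub>c Imp A\<^sub>1 A\<^sub>2"
| ImpE: "\<Gamma>\<^sub>1 \<turnstile>\<^sub>c Imp A\<^sub>1 A\<^sub>2 \<Longrightarrow> \<Gamma>\<^sub>2 \<turnstile>\<^sub>c A\<^sub>1 \<Longrightarrow> \<Gamma>\<^sub>1 |\<union>| \<Gamma>\<^sub>2 \<turnstile>\<^sub>c A\<^sub>2"
| BotC: "\<Gamma> \<turnstile>\<^sub>c Neg (Neg A) \<Longrightarrow> \<Gamma> \<turnstile>\<^sub>c A"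

inductive pml :: "'v mixed fset \<Rightarrow> 'v mixed \<Rightarrow> bool"  (infix "\<turnstile>\<^sub>p\<^sub>m\<^sub>l" 50) where
  Ax: "{|A|} \<turnstile>\<^sub>p\<^sub>m\<^sub>l A"
| W: "\<Gamma> \<turnstile>\<^sub>p\<^sub>m\<^sub>l A \<Longrightarrow> finsert B \<Gamma> \<turnstile>\<^sub>p\<^sub>m\<^sub>l A"
| AndI: "\<Gamma>\<^sub>1 \<turnstile>\<^sub>p\<^sub>m\<^sub>l A\<^sub>1 \<Longrightarrow> \<Gamma>\<^sub>2 \<turnstile>\<^sub>p\<^sub>m\<^sub>l A\<^sub>2 \<Longrightarrow> \<Gamma>\<^sub>1 |\<union>| \<Gamma>\<^sub>2 \<turnstile>\<^sub>p\<^sub>m\<^sub>l And A\<^sub>1 A\<^sub>2"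
| AndE1: "\<Gamma> \<turnstile>\<^sub>p\<^sub>m\<^sub>l And A\<^sub>1 A\<^sub>2 \<Longrightarrow> \<Gamma> \<turnstile>\<^sub>p\<^sub>m\<^sub>l A\<^sub>1"
| AndE2: "\<Gamma> \<turnstile>\<^sub>p\<^sub>m\<^sub>l And A\<^sub>1 A\<^sub>2 \<Longrightarrow> \<Gamma> \<turnstile>\<^sub>p\<^sub>m\<^sub>l A\<^sub>2"
| OrI1: "\<Gamma> \<turnstile>\<^sub>p\<^sub>m\<^sub>l A\<^sub>1 \<Longrightarrow> \<Gamma> \<turnstile>\<^sub>p\<^sub>m\<^sub>l Or A\<^sub>1 A\<^sub>2"
| OrI2: "\<Gamma> \<turnstile>\<^sub>p\<^sub>m\<^sub>l A\<^sub>2 \<Longrightarrow> \<Gamma> \<turnstile>\<^sub>p\<^sub>m\<^sub>l Or A\<^sub>1 A\<^sub>2"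
| OrE: "\<Gamma>\<^sub>1 \<turnstile>\<^sub>p\<^sub>m\<^sub>l Or A\<^sub>1 A\<^sub>2 \<Longrightarrow> finsert A\<^sub>1 \<Gamma>\<^sub>2 \<turnstile>\<^sub>p\<^sub>m\<^sub>l B \<Longrightarrow> finsert A\<^sub>2 \<Gamma>\<^sub>3 \<turnstile>\<^sub>p\<^sub>m\<^sub>l B
    \<Longrightarrow> \<Gamma>\<^sub>1 |\<union>| \<Gamma>\<^sub>2 |\<union>| \<Gamma>\<^sub>3 \<turnstile>\<^sub>p\<^sub>m\<^sub>l B"
| ImpI: "finsert A\<^sub>1 \<Gamma> \<turnstile>\<^sub>p\<^sub>m\<^sub>l A\<^sub>2 \<Longrightarrow> \<Gamma> \<turnstile>\<^sub>p\<^sub>m\<^sub>l Imp A\<^sub>1 A\<^sub>2"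
| ImpE: "\<Gamma>\<^sub>1 \<turnstile>\<^sub>p\<^sub>m\<^sub>l Imp A\<^sub>1 A\<^sub>2 \<Longrightarrow> \<Gamma>\<^sub>2 \<turnstile>\<^sub>p\<^sub>m\<^sub>l A\<^sub>1 \<Longrightarrow> \<Gamma>\<^sub>1 |\<union>| \<Gamma>\<^sub>2 \<turnstile>\<^sub>p\<^sub>m\<^sub>l A\<^sub>2"
| BotI: "\<Gamma> \<turnstile>\<^sub>p\<^sub>m\<^sub>l Bot \<Longrightarrow> intuitionistic A \<Longrightarrow> \<Gamma> \<turnstile>\<^sub>p\<^sub>m\<^sub>l A"
| BotC: "\<Gamma> \<turnstile>\<^sub>p\<^sub>m\<^sub>l Neg (Neg A) \<Longrightarrow> classical A \<Longrightarrow> \<Gamma> \<turnstile>\<^sub>p\<^sub>m\<^sub>l A"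

text \<open>The extension of a label \<open>l\<close> to ordinary formulas is \<open>map_form l\<close>.\<close>

definition is_label :: "('v \<Rightarrow> 'v mvar) \<Rightarrow> bool" where
  "is_label l \<longleftrightarrow> (\<forall>X. l X \<in> {VarM X, VarI X, VarC X})"

inductive mvar_less :: "'v mvar \<Rightarrow> 'v mvar \<Rightarrow> bool" where
  "mvar_less (VarM X) (VarI X)"
| "mvar_less (VarM X) (VarC X)"
| "mvar_less (VarI X) (VarC X)"

definition label_less :: "('v \<Rightarrow> 'v mvar) \<Rightarrow> ('v \<Rightarrow> 'v mvar) \<Rightarrow> bool" where
  "label_less l l' \<longleftrightarrow>
    (\<forall>X. mvar_less (l X) (l' X) \<or> l X = l' X) \<and> (\<exists>X. mvar_less (l X) (l' X))"

definition label_le :: "('v \<Rightarrow> 'v mvar) \<Rightarrow> ('v \<Rightarrow> 'v mvar) \<Rightarrow> bool" where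
  "label_le l l' \<longleftrightarrow> label_less l l' \<or> l = l'"

definition label_for :: "'v form \<Rightarrow> ('v \<Rightarrow> 'v mvar) \<Rightarrow> bool" where
  "label_for A l \<longleftrightarrow>
    is_label l \<and> {||} \<turnstile>\<^sub>p\<^sub>m\<^sub>l map_form l A \<and> (\<forall>X. X \<notin> vars A \<longrightarrow> l X = VarM X)"

definition minimal_label :: "'v form \<Rightarrow> ('v \<Rightarrow> 'v mvar) \<Rightarrow> bool" where
  "minimal_label A l \<longleftrightarrow>
    label_for A l \<and> (\<forall>l'. label_for A l' \<and> label_le l' l \<longrightarrow> l' = l)"

end

theory Submission
  imports Defs
begin

text \<open>Labels that are minimal on the variables not occurring in \<open>A\<close> form a finite poset, so it is
  enough that \<open>A\<close> has some label. The label that makes exactly the variables of \<open>A\<close> classical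
  is one: renaming every variable \<open>X\<close> to \<open>VarC X\<close> turns a classical derivation of \<open>A\<close> into a
  derivation in the mixed system (\<open>pml_map_VarC_if_plc\<close>), in which each double negation
  elimination is legitimate because the whole derivation consists of classical mixed formulas.
  Variables of the derivation foreign to \<open>A\<close> may stay classical inside it, since only the
  conclusion has to match the label. Instead of the finiteness of the poset, the descent uses
  the number of steps from the least label, which is finite since \<open>A\<close> has finitely many
  variables, and decreases strictly along the order (\<open>label_degree_less\<close>).\<close>

lemma classical_map_VarC: "classical (map_form VarC A)"
  by (auto simp: classical_def form.set_map)

lemma pml_map_VarC_if_plc:
  "\<Gamma> \<turnstile>\<^sub>c A \<Longrightarrow> map_form VarC |`| \<Gamma> \<turnstile>\<^sub>p\<^sub>m\<^sub>l map_form VarC A"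
proof (induction rule: plc.induct)
  case (BotC \<Gamma> A)
  then show ?case
    by (auto intro: pml.BotC classical_map_VarC)
qed (auto simp: fimage_funion intro: pml.intros)

lemma finite_vars: "finite (vars A)"
  by (induction A) auto

lemma ex_label_for_if_plc:
  assumes "{||} \<turnstile>\<^sub>c A"
  shows "\<exists>l. label_for A l"
proof
  let ?l = "\<lambda>X. if X \<in> vars A then VarC X else VarM X"
  have "map_form ?l A = map_form VarC A"
    by (rule form.map_cong0) simp
  then show "label_for A ?l"
    using pml_map_VarC_if_plc[OF assms] by (simp add: label_for_def is_label_def)
qed

fun mvar_degree :: "'v mvar \<Rightarrow> nat" where
  "mvar_degree (VarM X) = 0"
| "mvar_degree (VarI X) = 1"
| "mvar_degree (VarC X) = 2"

lemma mvar_degree_less: "mvar_less x y \<Longrightarrow> mvar_degree x < mvar_degree y"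
  by (induction rule: mvar_less.induct) auto

definition label_degree :: "'v form \<Rightarrow> ('v \<Rightarrow> 'v mvar) \<Rightarrow> nat" where
  "label_degree A l = (\<Sum>X\<in>vars A. mvar_degree (l X))"

text \<open>A label for \<open>A\<close> has degree zero at every variable outside \<open>A\<close>, so a strict
  decrease below it can only happen at a variable of \<open>A\<close>, where the sum sees it.\<close>

lemma label_degree_less:
  assumes "label_for A l" and less: "label_less l' l"
  shows "label_degree A l' < label_degree A l"
  unfolding label_degree_def
proof (rule sum_strict_mono_ex1[OF finite_vars])
  show "\<forall>X\<in>vars A. mvar_degree (l' X) \<le> mvar_degree (l X)"
    using less mvar_degree_less unfolding label_less_def by (metis less_imp_le order_refl)
  obtain X where X: "mvar_degree (l' X) < mvar_degree (l X)"
    using less mvar_degree_less unfolding label_less_def by blast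
  then have "l X \<noteq> VarM X"
    by auto
  then have "X \<in> vars A"
    using assms(1) by (auto simp: label_for_def)
  then show "\<exists>X\<in>vars A. mvar_degree (l' X) < mvar_degree (l X)"
    using X by blast
qed

theorem theorem43:
  fixes A :: "'v::countable form"
  assumes "{||} \<turnstile>\<^sub>c A"
  shows "\<exists>l. minimal_label A l"
proof -
  obtain l where l: "label_for A l"
    and least: "\<And>l'. label_for A l' \<Longrightarrow> label_degree A l \<le> label_degree A l'"
    using ex_label_for_if_plc[OF assms] ex_has_least_nat[of "label_for A" _ "label_degree A"]
    by blast
  have "l' = l" if "label_for A l'" "label_le l' l" for l'
    using label_degree_less[OF l] least[OF that(1)] that(2)
    unfolding label_le_def by (meson not_le)
  then show ?thesis
    using l unfolding minimal_label_def by blast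
qed

end
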